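(* Let $\Lambda$ be an $ADE$ Dynkin diagram and $Q_\Lambda=Q(\Lambda\times\Lambda)$. The operations $\bar\mu_v$ ($v\in\mathrm{Vert}(\Lambda)$), acting on labeled quivers $(Q_\Lambda,\rho)$ with $\rho:\mathrm{Vert}(Q_\Lambda)\to\mathbb{R}_{>0}$, satisfy the relations of the Coxeter group of $\Lambda$: for distinct vertices $u,w$ of $\Lambda$, $(\bar\mu_u\circ\bar\mu_w)^3=\mathrm{id}$ if $u$ and $w$ are adjacent in $\Lambda$, and $(\bar\mu_u\circ\bar\mu_w)^2=\mathrm{id}$ otherwise.
   Context: A quiver is a finite directed graph without loops and directed 2-cycles. Mutation $\mu_v$: for each pair of arrows $u\to v$, $v\to w$ add an arrow $u\to w$; reverse all arrows incident to $v$; then repeatedly remove both arrows of any directed 2-cycle. A labeled quiver is a pair $(Q,\rho)$ with $\rho:\mathrm{Vert}(Q)\to\mathbb{R}_{>0}$; the labeled mutation is $\tilde\mu_v(Q,\rho)=(\mu_v(Q),\rho')$ with $\rho'(u)=\rho(u)$ for $u\ne v$ and $\rho'(v)\rho(v)=\prod_{u\to v}\rho(u)+\prod_{v\to w}\rho(w)$. Fix an $ADE$ Dynkin diagram $\Lambda$ with a bipartition $\epsilon:\mathrm{Vert}(\Lambda)\to\{0,1\}$. The quiver $Q_\Lambda$ has vertices $v_1,v_2$ for each vertex $v$ of $\Lambda$, and for each edge $\{u,w\}$ of $\Lambda$ with $\epsilon(u)=0,\epsilon(w)=1$ the arrows $u_1\to w_1$, $u_2\to w_2$, $w_2\to u_1$,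 $w_1\to u_2$. For a vertex $v$ of $\Lambda$, the swap $s_v$ on labeled quivers with vertex set $\mathrm{Vert}(Q_\Lambda)$ exchanges the labels of $v_1$ and $v_2$ and exchanges the roles of $v_1,v_2$ in the arrows (arrows not incident to $v_1,v_2$ unchanged). Define $\bar\mu_v=s_v\circ\tilde\mu_{v_1}\circ\tilde\mu_{v_2}$; each $\bar\mu_v$ maps labeled quivers with underlying quiver $Q_\Lambda$ to labeled quivers with underlying quiver $Q_\Lambda$. *)

theory Defs
  imports Complex_Main "HOL-Library.FuncSet" "HOL-Combinatorics.Transposition"
begin

section \<open>Quivers and their mutations\<close>

text \<open>\<open>arr Q u w\<close> is the number of arrows \<open>u \<rightarrow> w\<close>.\<close>

record 'b quiver =
  verts :: "'b set"
  arr :: "'b \<Rightarrow> 'b \<Rightarrow> nat"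

definition is_quiver :: "'b quiver \<Rightarrow> bool" where
  "is_quiver Q \<longleftrightarrow> finite (verts Q)
     \<and> (\<forall>u w. arr Q u w \<noteq> 0 \<longrightarrow> u \<in> verts Q \<and> w \<in> verts Q)
     \<and> (\<forall>u. arr Q u u = 0)
     \<and> (\<forall>u w. arr Q u w = 0 \<or> arr Q w u = 0)"

definition add_paths :: "'b \<Rightarrow> 'b quiver \<Rightarrow> 'b quiver" where
  "add_paths v Q = Q\<lparr>arr := \<lambda>u w. arr Q u w + arr Q u v * arr Q v w\<rparr>"

definition reverse_at :: "'b \<Rightarrow> 'b quiver \<Rightarrow> 'b quiver" where
  "reverse_at v Q = Q\<lparr>arr := \<lambda>u w. if u = v \<or> w = v then arr Q w u else arr Q u w\<rparr>"

text \<open>Removing 2-cycles between \<open>u\<close> and \<open>w\<close> one at a time, until none is left, removes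
  \<open>min (arr Q u w) (arr Q w u)\<close> arrows in each direction; the subtraction is
  truncated.\<close>

definition cancel_two_cycles :: "'b quiver \<Rightarrow> 'b quiver" where
  "cancel_two_cycles Q = Q\<lparr>arr := \<lambda>u w. arr Q u w - arr Q w u\<rparr>"

definition mutate :: "'b \<Rightarrow> 'b quiver \<Rightarrow> 'b quiver" where
  "mutate v Q = cancel_two_cycles (reverse_at v (add_paths v Q))"

text \<open>In a labeled quiver \<open>(Q, \<rho>)\<close> only the values of \<open>\<rho>\<close> on \<open>verts Q\<close> are meaningful;
  no operation below changes the other values.\<close>

type_synonym 'b labeled_quiver = "'b quiver \<times> ('b \<Rightarrow> real)"

text \<open>The products run over arrows, hence the exponents.\<close>

definition lmutate :: "'b \<Rightarrow> 'b labeled_quiver \<Rightarrow> 'b labeled_quiver" where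
  "lmutate v = (\<lambda>(Q, \<rho>). (mutate v Q,
     \<rho>(v := ((\<Prod>u\<in>verts Q. \<rho> u ^ arr Q u v) + (\<Prod>w\<in>verts Q. \<rho> w ^ arr Q v w)) / \<rho> v)))"


section \<open>ADE Dynkin diagrams\<close>

text \<open>A graph is given by a vertex set and a set of two-element edges. The labelling of
  the standard diagrams is Bourbaki's.\<close>

inductive standard_ADE :: "nat set \<Rightarrow> nat set set \<Rightarrow> bool" where
  A: "n \<ge> 1 \<Longrightarrow> standard_ADE {1..n} {{i, i + 1} |i. 1 \<le> i \<and> i < n}"
| D: "n \<ge> 4 \<Longrightarrow> standard_ADE {1..n} (insert {n - 2, n} {{i, i + 1} |i. 1 \<le> i \<and> i < n - 1})"
| E: "n \<in> {6, 7, 8} \<Longrightarrow>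
      standard_ADE {1..n} ({{1, 3}, {2, 4}} \<union> {{i, i + 1} |i. 3 \<le> i \<and> i < n})"

definition ADE_diagram :: "'a set \<Rightarrow> 'a set set \<Rightarrow> bool" where
  "ADE_diagram V E \<longleftrightarrow> E \<subseteq> Pow V
     \<and> (\<exists>V' E' f. standard_ADE V' E' \<and> bij_betw f V V' \<and> (\<lambda>e. f ` e) ` E = E')"

definition bipartition :: "'a set \<Rightarrow> 'a set set \<Rightarrow> ('a \<Rightarrow> nat) \<Rightarrow> bool" where
  "bipartition V E \<epsilon> \<longleftrightarrow> \<epsilon> \<in> V \<rightarrow> {0, 1} \<and> (\<forall>u w. {u, w} \<in> E \<longrightarrow> \<epsilon> u \<noteq> \<epsilon> w)"


section \<open>The quiver of a diagram and the operations on it\<close>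

text \<open>The vertices \<open>v\<^sub>1\<close> and \<open>v\<^sub>2\<close> are \<open>(v, One)\<close> and \<open>(v, Two)\<close>.\<close>

datatype copy = One | Two

definition diagram_arrows :: "'a set set \<Rightarrow> ('a \<Rightarrow> nat) \<Rightarrow> (('a \<times> copy) \<times> ('a \<times> copy)) set" where
  "diagram_arrows E \<epsilon> = (\<Union>(u, w)\<in>{(u, w). {u, w} \<in> E \<and> \<epsilon> u = 0 \<and> \<epsilon> w = 1}.
     {((u, One), (w, One)), ((u, Two), (w, Two)), ((w, Two), (u, One)), ((w, One), (u, Two))})"

definition diagram_quiver :: "'a set \<Rightarrow> 'a set set \<Rightarrow> ('a \<Rightarrow> nat) \<Rightarrow> ('a \<times> copy) quiver" where
  "diagram_quiver V E \<epsilon> =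
     \<lparr>verts = V \<times> UNIV, arr = \<lambda>x y. if (x, y) \<in> diagram_arrows E \<epsilon> then 1 else 0\<rparr>"

lemma is_quiver_diagram_quiver:
  assumes "ADE_diagram V E" and "bipartition V E \<epsilon>"
  shows "is_quiver (diagram_quiver V E \<epsilon>)"
proof -
  have "finite V"
    using assms(1) by (auto simp: ADE_diagram_def bij_betw_finite elim!: standard_ADE.cases)
  moreover have "finite (UNIV :: copy set)"
    by (rule finite_subset[of _ "{One, Two}"]) (auto intro: copy.exhaust)
  moreover have "u \<in> V \<and> w \<in> V" if "{u, w} \<in> E" for u w
    using assms(1) that by (auto simp: ADE_diagram_def)
  ultimately show ?thesis
    by (auto simp: is_quiver_def diagram_quiver_def diagram_arrows_def)
qed

definition swap :: "'a \<Rightarrow> ('a \<times> copy) labeled_quiver \<Rightarrow> ('a \<times> copy) labeled_quiver" where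
  "swap v = (\<lambda>(Q, \<rho>). let \<tau> = transpose (v, One) (v, Two)
     in (Q\<lparr>arr := \<lambda>x y. arr Q (\<tau> x) (\<tau> y)\<rparr>, \<rho> \<circ> \<tau>))"

definition bar_mutate :: "'a \<Rightarrow> ('a \<times> copy) labeled_quiver \<Rightarrow> ('a \<times> copy) labeled_quiver" where
  "bar_mutate v = swap v \<circ> lmutate (v, One) \<circ> lmutate (v, Two)"

end

theory Submission imports Defs begin

text \<open>The operation at \<open>v\<close> sends the labels \<open>(\<rho> v\<^sub>1, \<rho> v\<^sub>2)\<close> to \<open>(S / \<rho> v\<^sub>2, S / \<rho> v\<^sub>1)\<close>, where
  \<open>S\<close> is the sum over \<open>i \<in> {1, 2}\<close> of the products of the labels \<open>\<rho> w\<^sub>i\<close> over the neighbours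
  \<open>w\<close> of \<open>v\<close>. It therefore preserves the ratio of the two labels at every vertex of the diagram.
  Writing a labeling as \<open>f w \<cdot> \<rho> w\<^sub>i\<close> with a fixed \<open>\<rho>\<close>, the operation becomes the monomial map
  \<open>f v \<mapsto> c v \<cdot> (\<Prod>w\<sim>v. f w) / f v\<close> with nonzero constants \<open>c v\<close>, for which the Coxeter
  relations are immediate.\<close>

lemma finite_copy: "finite (UNIV :: copy set)"
  by (rule finite_subset[of _ "{One, Two}"]) (auto intro: copy.exhaust)

lemma copy_neq_iff: "i \<noteq> One \<longleftrightarrow> i = Two" "i \<noteq> Two \<longleftrightarrow> i = One"
  by (cases i; simp)+

lemma prod_fun_upd:
  assumes "finite A"
  shows "prod (f(a := t)) A = (if a \<in> A then t * prod f (A - {a}) else prod f A)"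
proof (cases "a \<in> A")
  case True
  have "prod (f(a := t)) (A - {a}) = prod f (A - {a})"
    by (rule prod.cong) auto
  then show ?thesis
    using assms True by (simp add: prod.remove[of A a])
next
  case False
  then show ?thesis
    by (auto intro!: prod.cong)
qed

lemma verts_mutate [simp]: "verts (mutate v G) = verts G"
  by (simp add: mutate_def cancel_two_cycles_def reverse_at_def add_paths_def)

definition neighbours :: "'a set set \<Rightarrow> 'a \<Rightarrow> 'a set" where
  "neighbours E v = {w. {v, w} \<in> E}"

definition exchange_sum :: "'a set set \<Rightarrow> 'a \<Rightarrow> ('a \<times> copy \<Rightarrow> real) \<Rightarrow> real" where
  "exchange_sum E v \<rho> =
     (\<Prod>w\<in>neighbours E v. \<rho> (w, One)) + (\<Prod>w\<in>neighbours E v. \<rho> (w, Two))"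

definition scale :: "('a \<Rightarrow> real) \<Rightarrow> ('a \<times> copy \<Rightarrow> real) \<Rightarrow> 'a \<times> copy \<Rightarrow> real" where
  "scale f \<rho> = (\<lambda>(v, i). f v * \<rho> (v, i))"

lemma scale_one [simp]: "scale (\<lambda>_. 1) \<rho> = \<rho>"
  by (simp add: scale_def)

text \<open>The factor \<open>f w\<close> is shared by both copies of \<open>w\<close>, so it comes
  out of both products alike and leaves the constant \<open>exchange_sum E v \<rho>\<close>.\<close>

lemma exchange_sum_scale:
  "exchange_sum E v (scale f \<rho>) = prod f (neighbours E v) * exchange_sum E v \<rho>"
  by (simp add: exchange_sum_def scale_def prod.distrib distrib_left)

locale bipartite_graph =
  fixes V :: "'a set" and E :: "'a set set" and \<epsilon> :: "'a \<Rightarrow> nat"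
  assumes finite_V: "finite V"
    and edges: "E \<subseteq> Pow V"
    and bipartition: "bipartition V E \<epsilon>"
begin

abbreviation "Q \<equiv> diagram_quiver V E \<epsilon>"
abbreviation "N \<equiv> neighbours E"

lemma edge_cases:
  assumes "{u, w} \<in> E"
  shows "\<epsilon> u = 0 \<and> \<epsilon> w = 1 \<or> \<epsilon> u = 1 \<and> \<epsilon> w = 0"
proof -
  have "u \<in> V" "w \<in> V"
    using assms edges by auto
  then have "\<epsilon> u \<in> {0, 1}" "\<epsilon> w \<in> {0, 1}" "\<epsilon> u \<noteq> \<epsilon> w"
    using assms bipartition by (simp_all add: bipartition_def Pi_iff)
  then show ?thesis
    by auto
qed

lemma finite_neighbours: "finite (N v)"
  using edges by (intro finite_subset[OF _ finite_V]) (auto simp: neighbours_def)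

lemma neighbours_subset: "N v \<subseteq> V"
  using edges by (auto simp: neighbours_def)

lemma not_own_neighbour: "v \<notin> N v"
  using edge_cases[of v v] by (auto simp: neighbours_def)

lemma neighbours_sym: "w \<in> N v \<longleftrightarrow> v \<in> N w"
  by (simp add: neighbours_def insert_commute)

text \<open>With the arrow set in this form, the arrow computations below are finite case splits on
  parities and copies.\<close>

lemma arr_diagram_quiver:
  "arr Q (a, i) (b, j) =
     (if b \<in> N a \<and> (if \<epsilon> a = 0 then i = j else i \<noteq> j) then 1 else 0)"
  using edge_cases[of a b]
  by (cases i; cases j)
    (auto simp: diagram_quiver_def diagram_arrows_def neighbours_def insert_commute)

lemma neighbour_parity: "w \<in> N v \<Longrightarrow> (\<epsilon> w = 0) \<noteq> (\<epsilon> v = 0)"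
  using edge_cases[of v w] by (auto simp: neighbours_def)

text \<open>Nothing cancels here. An added arrow joins neighbours of \<open>v\<close>, which have
  equal parity and hence no arrow of \<open>Q\<close> between them. All arrows into
  \<open>(v, Two)\<close> start in one copy and all arrows out of it end in the other, so no two
  added arrows are opposite.\<close>

lemma arr_mutate_Two:
  "arr (mutate (v, Two) Q) x y =
     (if x = (v, Two) \<or> y = (v, Two) then arr Q y x
      else arr Q x y + arr Q x (v, Two) * arr Q (v, Two) y)"
proof -
  obtain a i b j where [simp]: "x = (a, i)" "y = (b, j)"
    by fastforce
  show ?thesis
    using neighbour_parity[of a v] neighbour_parity[of b v] neighbour_parity[of a b]
    by (cases i; cases j)
      (auto simp: mutate_def cancel_two_cycles_def reverse_at_def add_paths_def
        arr_diagram_quiver neighbours_sym not_own_neighbour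
        split: if_splits)
qed

text \<open>The in-neighbours of \<open>(v, One)\<close> are the out-neighbours of
  \<open>(v, Two)\<close> and vice versa. The arrows added at \<open>(v, One)\<close> are thus
  opposite to those added at \<open>(v, Two)\<close>, and they all cancel; only the reversals
  remain.\<close>

lemma arr_mutate_One_Two:
  "arr (mutate (v, One) (mutate (v, Two) Q)) x y =
     (if fst x = v \<or> fst y = v then arr Q y x else arr Q x y)"
proof -
  obtain a i b j where [simp]: "x = (a, i)" "y = (b, j)"
    by fastforce
  show ?thesis
    using neighbour_parity[of a v] neighbour_parity[of b v] neighbour_parity[of a b]
    unfolding mutate_def[of "(v, One)"]
    by (cases i; cases j)
      (auto simp: cancel_two_cycles_def reverse_at_def add_paths_def arr_mutate_Two
        arr_diagram_quiver neighbours_sym not_own_neighbour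
        split: if_splits)
qed

text \<open>For the same reason, reversing all arrows at the two copies of \<open>v\<close> has the
  same effect as exchanging the copies, which the swap undoes.\<close>

lemma swap_mutate_mutate:
  "(mutate (v, One) (mutate (v, Two) Q))
     \<lparr>arr := \<lambda>x y. arr (mutate (v, One) (mutate (v, Two) Q))
        (transpose (v, One) (v, Two) x) (transpose (v, One) (v, Two) y)\<rparr> = Q"
proof -
  have "arr (mutate (v, One) (mutate (v, Two) Q))
      (transpose (v, One) (v, Two) x) (transpose (v, One) (v, Two) y) = arr Q x y" for x y
  proof -
    obtain a i b j where [simp]: "x = (a, i)" "y = (b, j)"
      by fastforce
    show ?thesis
      using neighbour_parity[of a b]
      by (cases i; cases j)
        (auto simp: arr_mutate_One_Two transpose_def arr_diagram_quiver not_own_neighbour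
          neighbours_sym)
  qed
  then show ?thesis
    by (intro quiver.equality) auto
qed

lemma prod_labels:
  assumes "\<And>w j. k (w, j) = (if w \<in> N v \<and> j = i then 1 else (0::nat))"
  shows "(\<Prod>x\<in>verts Q. (\<rho> x :: real) ^ k x) = (\<Prod>w\<in>N v. \<rho> (w, i))"
proof -
  have "(\<Prod>x\<in>verts Q. \<rho> x ^ k x) = (\<Prod>x\<in>N v \<times> {i}. \<rho> x ^ k x)"
    using finite_V neighbours_subset
    by (intro prod.mono_neutral_right) (auto simp: diagram_quiver_def finite_copy assms split: if_splits)
  also have "\<dots> = (\<Prod>w\<in>N v. \<rho> (w, i))"
    by (intro prod.reindex_bij_witness[of _ "\<lambda>w. (w, i)" fst]) (auto simp: assms)
  finally show ?thesis .
qed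

text \<open>Stated for any \<open>G\<close> that agrees with \<open>Q\<close> at
  \<open>(v, i)\<close>, so as to cover both \<open>Q\<close> and \<open>mutate (v, Two) Q\<close>,
  where the second mutation takes place.\<close>

lemma exchange_relation:
  assumes "\<And>x. arr G x (v, i) = arr Q x (v, i)" "\<And>x. arr G (v, i) x = arr Q (v, i) x"
    and "verts G = verts Q"
  shows "(\<Prod>x\<in>verts G. \<rho> x ^ arr G x (v, i)) + (\<Prod>x\<in>verts G. \<rho> x ^ arr G (v, i) x)
    = exchange_sum E v \<rho>"
proof -
  define j where "j = (if i = One then Two else One)"
  \<comment> \<open>\<open>p\<close> and \<open>q\<close> are the copies that contain the
    in-neighbours and the out-neighbours of \<open>(v, i)\<close>. They are always different, so the
    sum is the same for both values of \<open>i\<close> and both parities of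
    \<open>v\<close>.\<close>
  define p where "p = (if \<epsilon> v = 0 then j else i)"
  define q where "q = (if \<epsilon> v = 0 then i else j)"
  have arr: "arr Q (w, k) (v, i) = (if w \<in> N v \<and> k = p then 1 else 0)"
    "arr Q (v, i) (w, k) = (if w \<in> N v \<and> k = q then 1 else 0)" for w k
    using neighbour_parity[of w v]
    by (cases i; cases k; auto simp: p_def q_def j_def arr_diagram_quiver neighbours_sym)+
  have "(\<Prod>x\<in>verts Q. \<rho> x ^ arr Q x (v, i)) = (\<Prod>w\<in>N v. \<rho> (w, p))"
    "(\<Prod>x\<in>verts Q. \<rho> x ^ arr Q (v, i) x) = (\<Prod>w\<in>N v. \<rho> (w, q))"
    by (rule prod_labels; rule arr)+
  then show ?thesis
    unfolding assms exchange_sum_def p_def q_def j_def by (cases i) auto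
qed

lemma bar_mutate_diagram_quiver:
  "bar_mutate v (Q, \<rho>) = (Q, \<rho>((v, One) := exchange_sum E v \<rho> / \<rho> (v, Two),
                               (v, Two) := exchange_sum E v \<rho> / \<rho> (v, One)))"
proof -
  define \<rho>' where "\<rho>' = \<rho>((v, Two) := exchange_sum E v \<rho> / \<rho> (v, Two))"
  have 1: "lmutate (v, Two) (Q, \<rho>) = (mutate (v, Two) Q, \<rho>')"
    by (simp add: lmutate_def \<rho>'_def exchange_relation)
  \<comment> \<open>The two copies of \<open>v\<close> are not joined, so no path through
    \<open>(v, Two)\<close> starts or ends at \<open>(v, One)\<close>.\<close>
  have "arr (mutate (v, Two) Q) x (v, One) = arr Q x (v, One)"
    "arr (mutate (v, Two) Q) (v, One) x = arr Q (v, One) x" for x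
    by (cases x; auto simp: arr_mutate_Two arr_diagram_quiver not_own_neighbour)+
  moreover have "exchange_sum E v \<rho>' = exchange_sum E v \<rho>"
    unfolding exchange_sum_def \<rho>'_def
    using not_own_neighbour by (intro arg_cong2[of _ _ _ _ "(+)"] prod.cong) auto
  ultimately have 2: "lmutate (v, One) (mutate (v, Two) Q, \<rho>') =
      (mutate (v, One) (mutate (v, Two) Q),
       \<rho>'((v, One) := exchange_sum E v \<rho> / \<rho> (v, One)))"
    by (simp add: lmutate_def exchange_relation) (simp add: \<rho>'_def)
  show ?thesis
    unfolding bar_mutate_def comp_apply 1 2
    by (simp add: swap_def Let_def swap_mutate_mutate) (auto simp: \<rho>'_def transpose_def fun_eq_iff)
qed

end

locale labeled_bipartite_graph = bipartite_graph +
  fixes \<rho> :: "'a \<times> copy \<Rightarrow> real"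
  assumes pos: "\<And>v i. v \<in> V \<Longrightarrow> \<rho> (v, i) > 0"
begin

text \<open>This is the \<open>c v\<close> of the monomial map. The swap crosses the denominators,
  so comparing the new label with the old one gives the same symmetric expression at both copies;
  one factor per vertex of the diagram therefore suffices.\<close>

definition coef :: "'a \<Rightarrow> real" where
  "coef v = exchange_sum E v \<rho> / (\<rho> (v, One) * \<rho> (v, Two))"

lemma coef_nonzero: "v \<in> V \<Longrightarrow> coef v \<noteq> 0"
proof -
  assume "v \<in> V"
  moreover have "exchange_sum E v \<rho> > 0"
    unfolding exchange_sum_def using neighbours_subset pos
    by (intro add_pos_pos prod_pos) auto
  ultimately show ?thesis
    using pos[of v] by (auto simp: coef_def less_imp_neq[symmetric])
qed

lemma bar_mutate_scale:
  assumes "v \<in> V"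
  shows "bar_mutate v (Q, scale f \<rho>) = (Q, scale (f(v := coef v * prod f (N v) / f v)) \<rho>)"
proof -
  have "\<rho> (v, i) \<noteq> 0" for i
    using pos[OF assms, of i] by simp
  then show ?thesis
    unfolding bar_mutate_diagram_quiver exchange_sum_scale
    by (auto simp: scale_def coef_def fun_eq_iff copy_neq_iff mult_ac)
qed

lemma bar_mutate_involution:
  assumes "v \<in> V"
  shows "(bar_mutate v ^^ 2) (Q, \<rho>) = (Q, \<rho>)"
proof -
  \<comment> \<open>The factor at \<open>v\<close> runs through 1, \<open>coef v\<close>, 1.\<close>
  have "(bar_mutate v ^^ 2) (Q, scale (\<lambda>_. 1) \<rho>) = (Q, scale (\<lambda>_. 1) \<rho>)"
    using coef_nonzero[OF assms] not_own_neighbour[of v]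
    by (simp add: numeral_2_eq_2 bar_mutate_scale assms prod_fun_upd finite_neighbours fun_upd_idem
        del: scale_one)
  then show ?thesis by simp
qed

text \<open>Only the factors \<open>s\<close> at \<open>u\<close> and \<open>t\<close> at
  \<open>w\<close> can differ from 1, so each neighbour product reduces to the factor of the other
  vertex or to 1. This family of labelings is closed under iteration; \<open>w\<close> acts first,
  so \<open>s'\<close> uses the new \<open>t'\<close>.\<close>

lemma bar_mutate_pair:
  assumes "u \<in> V" "w \<in> V" "u \<noteq> w"
  shows "(bar_mutate u \<circ> bar_mutate w) (Q, scale ((\<lambda>_. 1)(u := s, w := t)) \<rho>) =
    (let t' = coef w * (if w \<in> N u then s else 1) / t;
         s' = coef u * (if w \<in> N u then t' else 1) / s
     in (Q, scale ((\<lambda>_. 1)(u := s', w := t')) \<rho>))"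
  using assms not_own_neighbour[of u] not_own_neighbour[of w] neighbours_sym[of u w]
  by (simp add: Let_def bar_mutate_scale prod_fun_upd finite_neighbours fun_upd_twist
      del: fun_upd_apply add: fun_upd_same fun_upd_other)

lemma bar_mutate_braid:
  assumes "u \<in> V" "w \<in> V" "u \<noteq> w"
  shows "{u, w} \<in> E \<Longrightarrow> ((bar_mutate u \<circ> bar_mutate w) ^^ 3) (Q, \<rho>) = (Q, \<rho>)"
    and "{u, w} \<notin> E \<Longrightarrow> ((bar_mutate u \<circ> bar_mutate w) ^^ 2) (Q, \<rho>) = (Q, \<rho>)"
proof -
  \<comment> \<open>The labeling \<open>\<rho>\<close> has \<open>(s, t) = (1, 1)\<close>. With
    \<open>a = coef w\<close> and \<open>b = coef u\<close>, the orbit is \<open>(1, 1)\<close>,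
    \<open>(a * b, a)\<close>, \<open>(b, a * b)\<close>, \<open>(1, 1)\<close> for adjacent
    vertices and \<open>(1, 1)\<close>, \<open>(b, a)\<close>, \<open>(1, 1)\<close>
    otherwise.\<close>
  have "((bar_mutate u \<circ> bar_mutate w) ^^ (if w \<in> N u then 3 else 2))
      (Q, scale ((\<lambda>_. 1)(u := 1, w := 1)) \<rho>) = (Q, scale ((\<lambda>_. 1)(u := 1, w := 1)) \<rho>)"
    using coef_nonzero[OF assms(1)] coef_nonzero[OF assms(2)]
    by (simp add: numeral_2_eq_2 numeral_3_eq_3 bar_mutate_pair[OF assms, unfolded comp_def] Let_def
        del: fun_upd_apply)
  then show "{u, w} \<in> E \<Longrightarrow> ((bar_mutate u \<circ> bar_mutate w) ^^ 3) (Q, \<rho>) = (Q, \<rho>)"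
    and "{u, w} \<notin> E \<Longrightarrow> ((bar_mutate u \<circ> bar_mutate w) ^^ 2) (Q, \<rho>) = (Q, \<rho>)"
    by (simp_all add: fun_upd_idem neighbours_def)
qed

end

theorem theorem3p2:
  fixes V :: "'a set" and E :: "'a set set" and \<epsilon> :: "'a \<Rightarrow> nat"
    and \<rho> :: "'a \<times> copy \<Rightarrow> real"
  assumes "ADE_diagram V E"
    and "bipartition V E \<epsilon>"
    and "\<forall>x\<in>verts (diagram_quiver V E \<epsilon>). \<rho> x > 0"
  shows "(\<forall>v\<in>V. (bar_mutate v ^^ 2) (diagram_quiver V E \<epsilon>, \<rho>) = (diagram_quiver V E \<epsilon>, \<rho>))
    \<and> (\<forall>u\<in>V. \<forall>w\<in>V. u \<noteq> w \<longrightarrow>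
        ({u, w} \<in> E \<longrightarrow>
          ((bar_mutate u \<circ> bar_mutate w) ^^ 3) (diagram_quiver V E \<epsilon>, \<rho>)
            = (diagram_quiver V E \<epsilon>, \<rho>)) \<and>
        ({u, w} \<notin> E \<longrightarrow>
          ((bar_mutate u \<circ> bar_mutate w) ^^ 2) (diagram_quiver V E \<epsilon>, \<rho>)
            = (diagram_quiver V E \<epsilon>, \<rho>)))"
proof -
  have "finite V"
    using assms(1) by (auto simp: ADE_diagram_def bij_betw_finite elim!: standard_ADE.cases)
  then interpret labeled_bipartite_graph V E \<epsilon> \<rho>
    using assms by unfold_locales (auto simp: ADE_diagram_def diagram_quiver_def)
  show ?thesis
    by (simp add: bar_mutate_involution bar_mutate_braid)
qed

end
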